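(* For each $n$, let $\mathbf p=\{p_{ij}\}_{1\le i<j\le n}$ and $\mathbf p'=\{p_{ij}'\}_{1\le i<j\le n}$ be random vectors of probabilities in $[0,1]$ (both may depend on $n$), and suppose that with high probability $\max_{i,j}p_{ij}\le0.9$. (i) If $$\sum_{1\le i<j\le n}\frac{(p_{ij}-p_{ij}')^2}{p_{ij}}=o_p(1),$$ then $G(n,\mathbf p)\cong G(n,\mathbf p')$. (ii) If $$\sum_{1\le i<j\le n}\frac{(p_{ij}-p_{ij}')^2}{p_{ij}}=O_p(1),\qquad( * )$$ then $G(n,\mathbf p)\vartriangleright G(n,\mathbf p')$. (iii) If $( * )$ holds and further, for some constant $c>0$, with high probability $c\,p_{ij}\le p_{ij}'\le0.9$ for all $i,j$, then $G(n,\mathbf p)$ and $G(n,\mathbf p')$ are mutually contiguous, that is, $G(n,\mathbf p)\vartriangleleft G(n,\mathbf p')$ and $G(n,\mathbf p')\vartriangleleft G(n,\mathbf p)$.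
   Context: Random graph model: if $\mathbf p=\{p_{ij}\}_{1\le i<j\le n}$ is a random vector with entries in $[0,1]$, then $G(n,\mathbf p)$ is the random graph with vertex set $\{1,\dots,n\}$ such that, conditionally on $\mathbf p$, the indicators $I_{ij}$ of the events that edge $ij$ is present ($1\le i<j\le n$) are independent and $I_{ij}$ equals $1$ with probability $p_{ij}$. For each $n$, $\mathbf p$ and $\mathbf p'$ are defined on a common probability space. Conventions: all limits are as $n\to\infty$; "with high probability" means with probability tending to $1$ as $n\to\infty$. In the sums, $0/0$ is interpreted as $0$ (and $x/0=+\infty$ for $x>0$). For random quantities $S_n\in[0,\infty]$: $S_n=o_p(1)$ means $S_n\to0$ in probability; $S_n=O_p(1)$ means that for every $\varepsilon>0$ there exists $C$ such that $\mathbb P(S_n>C)<\varepsilon$ for all $n$. Asymptotic equivalence and contiguity: for random graphs $G_n,G_n'$ on $\{1,\dots,n\}$, $G_n\cong G_n'$ (asymptotically equivalent) means $\mathbb P(G_n\in A_n)-\mathbb P(G_n'\in A_n)\to0$ for every sequence of sets $A_n$ of graphs on $\{1,\dots,n\}$. $G_n\vartriangleleft G_n'$ ($G_n$ is contiguous with respect to $G_n'$) means that for every sequence of sets $A_n$ of graphs on $\{1,\dots,n\}$ with $\mathbb P(G_n'\in A_n)\to0$ one has $\mathbb P(G_n\in A_n)\to0$. $G_n\vartriangleright G_n'$ means $G_n'\vartriangleleft G_n$. *)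

theory Defs
  imports "HOL-Probability.Probability"
begin

(* A graph on {1..n} is identified with its set of edges, the edge joining i < j being the
   pair (i, j). *)
definition pairs :: "nat \<Rightarrow> (nat \<times> nat) set" where
  "pairs n = {(i, j). 1 \<le> i \<and> i < j \<and> j \<le> n}"

type_synonym graph = "(nat \<times> nat) set"

definition graphs :: "nat \<Rightarrow> graph set" where
  "graphs n = Pow (pairs n)"

definition prob_vector :: "nat \<Rightarrow> 'a measure \<Rightarrow> ('a \<Rightarrow> nat \<Rightarrow> nat \<Rightarrow> real) \<Rightarrow> bool" where
  "prob_vector n M p \<longleftrightarrow>
     (\<forall>(i, j) \<in> pairs n. (\<lambda>\<omega>. p \<omega> i j) \<in> borel_measurable M \<and>
        (\<forall>\<omega> \<in> space M. 0 \<le> p \<omega> i j \<and> p \<omega> i j \<le> 1))"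

definition fixed_random_graph :: "nat \<Rightarrow> (nat \<Rightarrow> nat \<Rightarrow> real) \<Rightarrow> graph pmf" where
  "fixed_random_graph n q =
     map_pmf (\<lambda>I. {e \<in> pairs n. I e})
       (Pi_pmf (pairs n) False (\<lambda>(i, j). bernoulli_pmf (q i j)))"

(* The law of G(n, p) for random p: the mixture, over the law M of the randomness in p, of
   the conditional laws of the graph given p. *)
definition random_graph :: "nat \<Rightarrow> 'a measure \<Rightarrow> ('a \<Rightarrow> nat \<Rightarrow> nat \<Rightarrow> real) \<Rightarrow> graph measure" where
  "random_graph n M p = M \<bind> (\<lambda>\<omega>. measure_pmf (fixed_random_graph n (p \<omega>)))"

(* In ennreal, 0 / 0 = 0 and x / 0 = \<infinity> for x > 0, which is the convention wanted here. *)
definition chi_sq :: "nat \<Rightarrow> (nat \<Rightarrow> nat \<Rightarrow> real) \<Rightarrow> (nat \<Rightarrow> nat \<Rightarrow> real) \<Rightarrow> ennreal" where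
  "chi_sq n q q' = (\<Sum>(i, j) \<in> pairs n. ennreal ((q i j - q' i j)\<^sup>2) / ennreal (q i j))"

definition whp :: "(nat \<Rightarrow> 'a measure) \<Rightarrow> (nat \<Rightarrow> 'a \<Rightarrow> bool) \<Rightarrow> bool" where
  "whp M P \<longleftrightarrow> (\<lambda>n. measure (M n) {\<omega> \<in> space (M n). P n \<omega>}) \<longlonglongrightarrow> 1"

definition small_o_p_one :: "(nat \<Rightarrow> 'a measure) \<Rightarrow> (nat \<Rightarrow> 'a \<Rightarrow> ennreal) \<Rightarrow> bool" where
  "small_o_p_one M S \<longleftrightarrow>
     (\<forall>\<epsilon>::real. \<epsilon> > 0 \<longrightarrow>
        (\<lambda>n. measure (M n) {\<omega> \<in> space (M n). S n \<omega> > ennreal \<epsilon>}) \<longlonglongrightarrow> 0)"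

definition big_O_p_one :: "(nat \<Rightarrow> 'a measure) \<Rightarrow> (nat \<Rightarrow> 'a \<Rightarrow> ennreal) \<Rightarrow> bool" where
  "big_O_p_one M S \<longleftrightarrow>
     (\<forall>\<epsilon>::real. \<epsilon> > 0 \<longrightarrow>
        (\<exists>C::real. C \<ge> 0 \<and>
           (\<forall>n. measure (M n) {\<omega> \<in> space (M n). S n \<omega> > ennreal C} < \<epsilon>)))"

definition asymp_equivalent :: "(nat \<Rightarrow> graph measure) \<Rightarrow> (nat \<Rightarrow> graph measure) \<Rightarrow> bool" where
  "asymp_equivalent G G' \<longleftrightarrow>
     (\<forall>A. (\<forall>n. A n \<subseteq> graphs n) \<longrightarrow>
        (\<lambda>n. measure (G n) (A n) - measure (G' n) (A n)) \<longlonglongrightarrow> 0)"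

(* contiguous G G' says that G is contiguous with respect to G': events unlikely for G' are
   unlikely for G. *)
definition contiguous :: "(nat \<Rightarrow> graph measure) \<Rightarrow> (nat \<Rightarrow> graph measure) \<Rightarrow> bool" where
  "contiguous G G' \<longleftrightarrow>
     (\<forall>A. (\<forall>n. A n \<subseteq> graphs n) \<longrightarrow>
        (\<lambda>n. measure (G' n) (A n)) \<longlonglongrightarrow> 0 \<longrightarrow>
        (\<lambda>n. measure (G n) (A n)) \<longlonglongrightarrow> 0)"

end

theory Submission
  imports Defs
begin

text \<open>Write P and Q for the conditional laws of the two graphs given the edge probabilities,
  and S for the sum in the hypothesis. The \<chi>-squared divergence is multiplicative over the
  independent edges, so as long as all entries of p are at most 0.9, the sum over all graphs g
  of Q(g)^2 / P(g) is at most exp (10 S). By the Cauchy--Schwarz inequality,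
  Q(A)^2 \<le> P(A) exp (10 S) and (Q(A) - P(A))^2 \<le> exp (10 S) - 1 for every event A.
  Integrating these bounds over the event that p is at most 0.9 and S is small (respectively
  bounded) gives (i) and (ii). Part (iii) is (ii) applied twice, since exchanging p and p'
  increases S at most by the factor 1 / c.\<close>

section \<open>Two tools for finite sums\<close>

text \<open>Expanding the product of the binomials \<open>f e + h e\<close> gives one term for each
  subset \<open>g\<close>, the set of those \<open>e\<close> at which the summand \<open>f e\<close>
  is picked.\<close>

lemma sum_Pow_prod_if:
  fixes f h :: "'b \<Rightarrow> 'c::comm_semiring_1"
  assumes "finite E"
  shows "(\<Sum>g\<in>Pow E. \<Prod>e\<in>E. if e \<in> g then f e else h e) = (\<Prod>e\<in>E. f e + h e)"
proof -
  have "(\<Prod>e\<in>E. if e \<in> g then f e else h e) = (\<Prod>e\<in>g. f e) * (\<Prod>e\<in>E - g. h e)"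
    if "g \<subseteq> E" for g
    using assms that by (simp add: prod.If_cases Int_absorb1 Diff_eq)
  then show ?thesis
    using assms by (simp add: prod_add)
qed

text \<open>Cauchy--Schwarz applied to the splitting of \<open>u\<close> into \<open>sqrt w\<close>
  and \<open>u / sqrt w\<close>. Where \<open>w\<close> vanishes the quotient is 0 by convention, so
  the splitting is correct there only because \<open>u\<close> vanishes too.\<close>

lemma Cauchy_Schwarz_sum_weighted:
  fixes u w :: "'b \<Rightarrow> real"
  assumes "\<And>x. x \<in> A \<Longrightarrow> 0 \<le> w x" and "\<And>x. x \<in> A \<Longrightarrow> w x = 0 \<Longrightarrow> u x = 0"
  shows "(sum u A)\<^sup>2 \<le> sum w A * (\<Sum>x\<in>A. (u x)\<^sup>2 / w x)"
proof -
  have "sum u A = (\<Sum>x\<in>A. sqrt (w x) * (u x / sqrt (w x)))"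
    using assms by (intro sum.cong) auto
  also have "\<dots>\<^sup>2 \<le> (\<Sum>x\<in>A. (sqrt (w x))\<^sup>2) * (\<Sum>x\<in>A. (u x / sqrt (w x))\<^sup>2)"
    by (rule Cauchy_Schwarz_ineq_sum)
  also have "(\<Sum>x\<in>A. (sqrt (w x))\<^sup>2) = sum w A"
    using assms by (intro sum.cong) auto
  also have "(\<Sum>x\<in>A. (u x / sqrt (w x))\<^sup>2) = (\<Sum>x\<in>A. (u x)\<^sup>2 / w x)"
    using assms by (intro sum.cong) (auto simp: power_divide)
  finally show ?thesis .
qed

section \<open>Second-moment bounds for fixed edge probabilities\<close>

text \<open>For \<open>q\<close> with values in [0,1] and \<open>g\<close> a subset of
  \<open>E\<close>, this is the probability that a random subset of \<open>E\<close>, containing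
  each \<open>e\<close> independently with probability \<open>q e\<close>, equals
  \<open>g\<close>.\<close>

definition edge_weight :: "'e set \<Rightarrow> ('e \<Rightarrow> real) \<Rightarrow> 'e set \<Rightarrow> real" where
  "edge_weight E q g = (\<Prod>e\<in>E. if e \<in> g then q e else 1 - q e)"

lemma edge_weight_nonneg:
  assumes "\<And>e. e \<in> E \<Longrightarrow> 0 \<le> q e \<and> q e \<le> 1"
  shows "0 \<le> edge_weight E q g"
  unfolding edge_weight_def using assms by (intro prod_nonneg) auto

lemma sum_edge_weight: "finite E \<Longrightarrow> sum (edge_weight E q) (Pow E) = 1"
  unfolding edge_weight_def by (subst sum_Pow_prod_if) auto

text \<open>The deterministic situation for one outcome in the good event. Real division gives x/0 =
  0, so \<open>chi_le\<close> says nothing about edges with \<open>q e = 0\<close>;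
  \<open>abs_cont\<close> records separately what a finite sum in [0,\<infinity>] would imply
  there.\<close>

locale edge_probabilities =
  fixes E :: "'e set" and q q' :: "'e \<Rightarrow> real" and C :: real
  assumes finite_E: "finite E"
    and q: "\<And>e. e \<in> E \<Longrightarrow> 0 \<le> q e \<and> q e \<le> 0.9"
    and q': "\<And>e. e \<in> E \<Longrightarrow> 0 \<le> q' e \<and> q' e \<le> 1"
    and abs_cont: "\<And>e. e \<in> E \<Longrightarrow> q e = 0 \<Longrightarrow> q' e = 0"
    and chi_le: "(\<Sum>e\<in>E. (q e - q' e)\<^sup>2 / q e) \<le> C"
begin

lemma weight_nonneg: "0 \<le> edge_weight E q g"
  using q by (intro edge_weight_nonneg) force

text \<open>A vanishing product has a vanishing factor. It cannot be \<open>1 - q e\<close>, because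
  \<open>q e\<close> is at most 0.9, so it is \<open>q e\<close> for some edge of \<open>g\<close>,
  and then the corresponding factor \<open>q' e\<close> vanishes as well.\<close>

lemma weight_abs_cont:
  assumes "edge_weight E q g = 0"
  shows "edge_weight E q' g = 0"
proof -
  obtain e where e: "e \<in> E" "(if e \<in> g then q e else 1 - q e) = 0"
    using assms finite_E unfolding edge_weight_def prod_zero_iff[OF finite_E] by blast
  have "q' e = 0" "e \<in> g"
    using e q[of e] abs_cont[of e] by (auto split: if_splits)
  then show ?thesis
    using e(1) finite_E by (auto simp: edge_weight_def intro!: prod_zero)
qed

text \<open>With r = \<open>q e\<close> > 0 and s = \<open>q' e\<close>, the left side equals 1 + (r
  - s)^2 / (r (1 - r)). The bound r \<le> 0.9 gives 1 / (1 - r) \<le> 10, which is the origin of the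
  constant 10, and 1 + x \<le> exp x finishes.\<close>

lemma edge_second_moment:
  assumes "e \<in> E"
  shows "(q' e)\<^sup>2 / q e + (1 - q' e)\<^sup>2 / (1 - q e) \<le> exp (10 * ((q e - q' e)\<^sup>2 / q e))"
proof (cases "q e = 0")
  \<comment> \<open>Here \<open>q' e = 0\<close> too, and with 0/0 = 0 both sides equal 1.\<close>
  case True
  then show ?thesis using abs_cont[OF assms] by simp
next
  case False
  define r s where "r = q e" and "s = q' e"
  have r: "0 < r" "r \<le> 0.9" using False q[OF assms] by (auto simp: r_def)
  have "s\<^sup>2 / r + (1 - s)\<^sup>2 / (1 - r) = 1 + ((r - s)\<^sup>2 / r) * (1 / (1 - r))"
    using r by (simp add: divide_simps) (simp add: power2_eq_square algebra_simps)
  also have "\<dots> \<le> 1 + ((r - s)\<^sup>2 / r) * 10"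
    using r by (intro add_left_mono mult_left_mono) (auto simp: divide_simps)
  also have "\<dots> \<le> exp (10 * ((r - s)\<^sup>2 / r))"
    using exp_ge_add_one_self[of "10 * ((r - s)\<^sup>2 / r)"] by (simp add: mult.commute)
  finally show ?thesis by (simp add: r_def s_def)
qed

text \<open>Each summand is a product over edges, so the sum over graphs factors into the sums
  bounded in \<open>edge_second_moment\<close>; the exponents then add up to 10 times the sum in
  \<open>chi_le\<close>.\<close>

lemma second_moment: "(\<Sum>g\<in>Pow E. (edge_weight E q' g)\<^sup>2 / edge_weight E q g) \<le> exp (10 * C)"
proof -
  have "(\<Sum>g\<in>Pow E. (edge_weight E q' g)\<^sup>2 / edge_weight E q g) =
      (\<Sum>g\<in>Pow E. \<Prod>e\<in>E. if e \<in> g then (q' e)\<^sup>2 / q e else (1 - q' e)\<^sup>2 / (1 - q e))"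
    unfolding edge_weight_def prod_power_distrib prod_dividef[symmetric]
    by (intro sum.cong prod.cong refl) auto
  also have "\<dots> = (\<Prod>e\<in>E. (q' e)\<^sup>2 / q e + (1 - q' e)\<^sup>2 / (1 - q e))"
    by (rule sum_Pow_prod_if[OF finite_E])
  also have "\<dots> \<le> (\<Prod>e\<in>E. exp (10 * ((q e - q' e)\<^sup>2 / q e)))"
    using edge_second_moment q by (intro prod_mono) (force intro!: add_nonneg_nonneg divide_nonneg_nonneg)
  also have "\<dots> = exp (10 * (\<Sum>e\<in>E. (q e - q' e)\<^sup>2 / q e))"
    by (simp add: exp_sum finite_E sum_distrib_left)
  also have "\<dots> \<le> exp (10 * C)"
    using chi_le by simp
  finally show ?thesis .
qed

lemma sum_weight_sq_le:
  assumes "A \<subseteq> Pow E"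
  shows "(sum (edge_weight E q') A)\<^sup>2 \<le> sum (edge_weight E q) A * exp (10 * C)"
proof -
  have "(sum (edge_weight E q') A)\<^sup>2 \<le>
      sum (edge_weight E q) A * (\<Sum>g\<in>A. (edge_weight E q' g)\<^sup>2 / edge_weight E q g)"
    by (intro Cauchy_Schwarz_sum_weighted weight_nonneg weight_abs_cont)
  also have "(\<Sum>g\<in>A. (edge_weight E q' g)\<^sup>2 / edge_weight E q g) \<le>
      (\<Sum>g\<in>Pow E. (edge_weight E q' g)\<^sup>2 / edge_weight E q g)"
    using finite_E assms by (intro sum_mono2) (auto simp: weight_nonneg)
  finally show ?thesis
    using second_moment by (meson mult_left_mono order_trans sum_nonneg weight_nonneg)
qed

text \<open>Cauchy--Schwarz for the difference of the two weights, the total weight of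
  \<open>A\<close> under \<open>q\<close> being at most 1. The remaining sum over all graphs is the
  chi-squared divergence, that is, the second moment minus 1.\<close>

lemma sum_weight_diff_sq_le:
  assumes "A \<subseteq> Pow E"
  shows "(sum (edge_weight E q') A - sum (edge_weight E q) A)\<^sup>2 \<le> exp (10 * C) - 1"
proof -
  let ?w = "edge_weight E q" and ?w' = "edge_weight E q'"
  have "(sum ?w' A - sum ?w A)\<^sup>2 = (\<Sum>g\<in>A. ?w' g - ?w g)\<^sup>2"
    by (simp add: sum_subtractf)
  also have "\<dots> \<le> sum ?w A * (\<Sum>g\<in>A. (?w' g - ?w g)\<^sup>2 / ?w g)"
    by (intro Cauchy_Schwarz_sum_weighted) (auto simp: weight_nonneg weight_abs_cont)
  also have "\<dots> \<le> 1 * (\<Sum>g\<in>Pow E. (?w' g - ?w g)\<^sup>2 / ?w g)"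
  proof (rule mult_mono)
    show "sum ?w A \<le> 1"
      using assms finite_E sum_mono2[of "Pow E" A ?w] by (simp add: sum_edge_weight weight_nonneg)
    show "(\<Sum>g\<in>A. (?w' g - ?w g)\<^sup>2 / ?w g) \<le> (\<Sum>g\<in>Pow E. (?w' g - ?w g)\<^sup>2 / ?w g)"
      using assms finite_E by (intro sum_mono2) (auto simp: weight_nonneg)
  qed (auto intro!: sum_nonneg simp: weight_nonneg)
  also have "\<dots> = (\<Sum>g\<in>Pow E. (?w' g)\<^sup>2 / ?w g - 2 * ?w' g + ?w g)"
  proof -
    \<comment> \<open>If \<open>?w g = 0\<close>, then \<open>?w' g = 0\<close> by absolute
      continuity and both sides are 0.\<close>
    have "(?w' g - ?w g)\<^sup>2 / ?w g = (?w' g)\<^sup>2 / ?w g - 2 * ?w' g + ?w g" for g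
      using weight_abs_cont[of g]
      by (cases "?w g = 0") (auto simp: field_simps power2_eq_square)
    then show ?thesis by simp
  qed
  \<comment> \<open>Both weights sum to 1, so the last two terms contribute -2 + 1.\<close>
  also have "\<dots> = (\<Sum>g\<in>Pow E. (?w' g)\<^sup>2 / ?w g) - 1"
    using finite_E
    by (simp add: sum.distrib sum_subtractf sum_distrib_left[symmetric] sum_edge_weight)
  finally show ?thesis using second_moment by linarith
qed

end

section \<open>The random graph with fixed edge probabilities\<close>

lemma finite_pairs: "finite (pairs n)"
  by (rule finite_subset[of _ "{1..n} \<times> {1..n}"]) (auto simp: pairs_def)

lemma set_pmf_fixed_random_graph: "set_pmf (fixed_random_graph n q) \<subseteq> graphs n"
  by (auto simp: fixed_random_graph_def graphs_def)

lemma pmf_fixed_random_graph: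
  assumes q: "\<And>i j. (i, j) \<in> pairs n \<Longrightarrow> 0 \<le> q i j \<and> q i j \<le> 1" and g: "g \<in> graphs n"
  shows "pmf (fixed_random_graph n q) g = edge_weight (pairs n) (\<lambda>(i, j). q i j) g"
proof -
  let ?P = "Pi_pmf (pairs n) False (\<lambda>(i, j). bernoulli_pmf (q i j))"
  have "pmf (fixed_random_graph n q) g = measure ?P ((\<lambda>I. {e \<in> pairs n. I e}) -` {g})"
    by (simp add: fixed_random_graph_def pmf_map)
  \<comment> \<open>Almost surely the indicator function takes the default value
    \<open>False\<close> outside \<open>pairs n\<close>, so the only one producing \<open>g\<close>
    is membership in \<open>g\<close>.\<close>
  also have "\<dots> = measure ?P {\<lambda>e. e \<in> g}"
  proof (rule measure_eq_AE)
    show "AE I in ?P. I \<in> (\<lambda>I. {e \<in> pairs n. I e}) -` {g} \<longleftrightarrow> I \<in> {\<lambda>e. e \<in> g}"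
      using set_Pi_pmf_subset[OF finite_pairs, of n False "\<lambda>(i, j). bernoulli_pmf (q i j)"] g
      by (fastforce simp: AE_measure_pmf_iff graphs_def fun_eq_iff)
  qed auto
  also have "\<dots> = (\<Prod>e\<in>pairs n. pmf (case e of (i, j) \<Rightarrow> bernoulli_pmf (q i j)) (e \<in> g))"
    using g by (subst measure_pmf_single, subst pmf_Pi'[OF finite_pairs]) (auto simp: graphs_def)
  also have "\<dots> = edge_weight (pairs n) (\<lambda>(i, j). q i j) g"
    unfolding edge_weight_def using q by (intro prod.cong) auto
  finally show ?thesis .
qed

lemma measure_fixed_random_graph:
  assumes "\<And>i j. (i, j) \<in> pairs n \<Longrightarrow> 0 \<le> q i j \<and> q i j \<le> 1"
  shows "measure (fixed_random_graph n q) A =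
    sum (edge_weight (pairs n) (\<lambda>(i, j). q i j)) (A \<inter> graphs n)"
proof -
  have "measure (fixed_random_graph n q) A = measure (fixed_random_graph n q) (A \<inter> graphs n)"
    using set_pmf_fixed_random_graph[of n q] by (intro measure_eq_AE) (auto simp: AE_measure_pmf_iff)
  also have "\<dots> = sum (pmf (fixed_random_graph n q)) (A \<inter> graphs n)"
    by (intro measure_measure_pmf_finite) (simp add: graphs_def finite_pairs)
  also have "\<dots> = sum (edge_weight (pairs n) (\<lambda>(i, j). q i j)) (A \<inter> graphs n)"
    using assms by (intro sum.cong pmf_fixed_random_graph) auto
  finally show ?thesis .
qed

section \<open>The chi-squared sum in real arithmetic and the good event\<close>

text \<open>Translates between the conventions x/0 = \<infinity> in \<open>ennreal\<close> and x/0 =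
  0 in the reals: the first conjunct excludes exactly the infinite terms, and all other terms
  agree.\<close>

lemma chi_sq_le_iff:
  assumes q: "\<And>i j. (i, j) \<in> pairs n \<Longrightarrow> 0 \<le> q i j" and C: "0 \<le> C"
  shows "chi_sq n q q' \<le> ennreal C \<longleftrightarrow>
    (\<forall>(i, j)\<in>pairs n. q i j = 0 \<longrightarrow> q' i j = 0) \<and>
    (\<Sum>(i, j)\<in>pairs n. (q i j - q' i j)\<^sup>2 / q i j) \<le> C"
proof (cases "\<forall>(i, j)\<in>pairs n. q i j = 0 \<longrightarrow> q' i j = 0")
  case True
  have "chi_sq n q q' = (\<Sum>(i, j)\<in>pairs n. ennreal ((q i j - q' i j)\<^sup>2 / q i j))"
    unfolding chi_sq_def
  proof (intro sum.cong refl, clarify)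
    fix i j assume ij: "(i, j) \<in> pairs n"
    show "ennreal ((q i j - q' i j)\<^sup>2) / ennreal (q i j) = ennreal ((q i j - q' i j)\<^sup>2 / q i j)"
      using True q[OF ij] ij by (cases "q i j = 0") (auto simp: divide_ennreal)
  qed
  also have "\<dots> = ennreal (\<Sum>(i, j)\<in>pairs n. (q i j - q' i j)\<^sup>2 / q i j)"
    using q by (simp add: case_prod_beta sum_ennreal)
  finally show ?thesis using True C by simp
next
  case False
  then obtain i j where ij: "(i, j) \<in> pairs n" "q i j = 0" "q' i j \<noteq> 0" by auto
  have "ennreal ((q i j - q' i j)\<^sup>2) / ennreal (q i j) = \<infinity>"
    using ij by simp
  then have "chi_sq n q q' = \<infinity>"
    unfolding chi_sq_def by (simp add: sum.remove[OF finite_pairs ij(1)])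
  then show ?thesis using False by (simp add: top_unique)
qed

text \<open>The good event on which the deterministic bounds apply. It is not symmetric: only
  \<open>q\<close> is bounded by 0.9 and appears in the denominators.\<close>

definition well_conditioned :: "nat \<Rightarrow> real \<Rightarrow> (nat \<Rightarrow> nat \<Rightarrow> real) \<Rightarrow> (nat \<Rightarrow> nat \<Rightarrow> real) \<Rightarrow> bool" where
  "well_conditioned n C q q' \<longleftrightarrow> (\<forall>(i, j)\<in>pairs n. q i j \<le> 0.9) \<and> chi_sq n q q' \<le> ennreal C"

lemma well_conditioned_imp_edge_probabilities:
  assumes "well_conditioned n C q q'" and "0 \<le> C"
    and "\<And>i j. (i, j) \<in> pairs n \<Longrightarrow> 0 \<le> q i j \<and> q i j \<le> 1"
    and "\<And>i j. (i, j) \<in> pairs n \<Longrightarrow> 0 \<le> q' i j \<and> q' i j \<le> 1"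
  shows "edge_probabilities (pairs n) (\<lambda>(i, j). q i j) (\<lambda>(i, j). q' i j) C"
proof -
  have "chi_sq n q q' \<le> ennreal C"
    using assms by (simp add: well_conditioned_def)
  then have "(\<forall>(i, j)\<in>pairs n. q i j = 0 \<longrightarrow> q' i j = 0) \<and>
      (\<Sum>(i, j)\<in>pairs n. (q i j - q' i j)\<^sup>2 / q i j) \<le> C"
    using assms by (subst (asm) chi_sq_le_iff) auto
  then show ?thesis
    using assms finite_pairs
    by unfold_locales (auto simp: well_conditioned_def case_prod_beta)
qed

text \<open>The numerators are symmetric, and replacing the denominator \<open>q i j\<close> by
  \<open>q' i j\<close>, which is at least \<open>c * q i j\<close>, costs at most a factor 1 / c.
  The same inequality shows that \<open>q i j\<close> vanishes where \<open>q' i j\<close>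
  does.\<close>

lemma well_conditioned_swap:
  assumes wc: "well_conditioned n C q q'" and "0 \<le> C" and "0 < c"
    and q: "\<And>i j. (i, j) \<in> pairs n \<Longrightarrow> 0 \<le> q i j"
    and q': "\<And>i j. (i, j) \<in> pairs n \<Longrightarrow> c * q i j \<le> q' i j \<and> q' i j \<le> 0.9"
  shows "well_conditioned n (C / c) q' q"
proof -
  have chi: "(\<Sum>(i, j)\<in>pairs n. (q i j - q' i j)\<^sup>2 / q i j) \<le> C"
    and ac: "\<And>i j. (i, j) \<in> pairs n \<Longrightarrow> q i j = 0 \<Longrightarrow> q' i j = 0"
    using wc chi_sq_le_iff[OF q \<open>0 \<le> C\<close>, where q' = q'] by (auto simp: well_conditioned_def)
  have q'_nonneg: "0 \<le> q' i j" if "(i, j) \<in> pairs n" for i j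
    using q[OF that] q'[OF that] \<open>0 < c\<close> by (meson order_trans mult_nonneg_nonneg less_imp_le)
  have "(\<Sum>(i, j)\<in>pairs n. (q' i j - q i j)\<^sup>2 / q' i j) \<le>
      (\<Sum>(i, j)\<in>pairs n. (q i j - q' i j)\<^sup>2 / q i j / c)"
  proof (intro sum_mono, clarify)
    fix i j assume ij: "(i, j) \<in> pairs n"
    show "(q' i j - q i j)\<^sup>2 / q' i j \<le> (q i j - q' i j)\<^sup>2 / q i j / c"
    proof (cases "q i j = 0")
      case True
      then show ?thesis using ac[OF ij] by simp
    next
      case False
      then have "0 < c * q i j" using q[OF ij] \<open>0 < c\<close> by simp
      moreover from this have "0 < q' i j" using q'[OF ij] by simp
      ultimately have "(q i j - q' i j)\<^sup>2 / q' i j \<le> (q i j - q' i j)\<^sup>2 / (c * q i j)"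
        using q'[OF ij] by (intro divide_left_mono) auto
      then show ?thesis by (simp add: power2_commute mult.commute)
    qed
  qed
  also have "\<dots> = (\<Sum>(i, j)\<in>pairs n. (q i j - q' i j)\<^sup>2 / q i j) / c"
    by (simp add: sum_divide_distrib case_prod_beta)
  also have "\<dots> \<le> C / c"
    using chi \<open>0 < c\<close> by (simp add: divide_right_mono)
  finally have sum_le: "(\<Sum>(i, j)\<in>pairs n. (q' i j - q i j)\<^sup>2 / q' i j) \<le> C / c" .
  have "q i j = 0" if "(i, j) \<in> pairs n" "q' i j = 0" for i j
    using q[OF that(1)] q'[OF that(1)] that(2) \<open>0 < c\<close> by (auto simp: mult_le_0_iff)
  then have "chi_sq n q' q \<le> ennreal (C / c)"
    using sum_le q'_nonneg \<open>0 < c\<close> \<open>0 \<le> C\<close> by (subst chi_sq_le_iff) auto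
  then show ?thesis
    using q' by (auto simp: well_conditioned_def)
qed

section \<open>Measurability and the mixture over random edge probabilities\<close>

lemma prob_vectorD:
  assumes "prob_vector n M p" "\<omega> \<in> space M" "(i, j) \<in> pairs n"
  shows "0 \<le> p \<omega> i j \<and> p \<omega> i j \<le> 1"
  using assms unfolding prob_vector_def by blast

lemma prob_vector_measurable:
  assumes "prob_vector n M p" "e \<in> pairs n"
  shows "(\<lambda>\<omega>. p \<omega> (fst e) (snd e)) \<in> borel_measurable M"
  using assms unfolding prob_vector_def by (cases e) auto

text \<open>By \<open>measure_fixed_random_graph\<close> the conditional probability is a polynomial
  in finitely many measurable entries.\<close>

lemma measurable_fixed_random_graph:
  assumes p: "prob_vector n M p"
  shows "(\<lambda>\<omega>. measure (fixed_random_graph n (p \<omega>)) A) \<in> borel_measurable M"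
proof -
  note [measurable] = prob_vector_measurable[OF p]
  have "(\<lambda>\<omega>. \<Sum>g\<in>A \<inter> graphs n. \<Prod>e\<in>pairs n.
      if e \<in> g then p \<omega> (fst e) (snd e) else 1 - p \<omega> (fst e) (snd e)) \<in> borel_measurable M"
  proof (intro borel_measurable_sum borel_measurable_prod)
    fix g e assume [measurable]: "e \<in> pairs n"
    show "(\<lambda>\<omega>. if e \<in> g then p \<omega> (fst e) (snd e) else 1 - p \<omega> (fst e) (snd e)) \<in> borel_measurable M"
      by (cases "e \<in> g") auto
  qed
  then show ?thesis
    using prob_vectorD[OF p]
    by (subst measurable_cong, subst measure_fixed_random_graph)
       (auto simp: edge_weight_def case_prod_beta)
qed

text \<open>The law of total probability; the point to check is that the conditional law is a
  measurable kernel, as \<open>measure_bind\<close> requires.\<close>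

lemma measure_random_graph:
  assumes "prob_space M" and p: "prob_vector n M p"
  shows "measure (random_graph n M p) A = (\<integral>\<omega>. measure (fixed_random_graph n (p \<omega>)) A \<partial>M)"
proof -
  interpret prob_space M by fact
  have "(\<lambda>\<omega>. measure_pmf (fixed_random_graph n (p \<omega>))) \<in> measurable M (subprob_algebra (count_space UNIV))"
  proof (rule measurable_subprob_algebra)
    show "(\<lambda>\<omega>. emeasure (measure_pmf (fixed_random_graph n (p \<omega>))) A) \<in> borel_measurable M" for A
      using measurable_fixed_random_graph[OF p, of A]
      by (simp add: measure_pmf.emeasure_eq_measure)
  qed (auto intro: measure_pmf.subprob_space_axioms)
  then show ?thesis
    unfolding random_graph_def by (rule measure_bind) simp
qed

lemma measurable_chi_sq:
  assumes "prob_vector n M p" "prob_vector n M p'"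
  shows "(\<lambda>\<omega>. chi_sq n (p \<omega>) (p' \<omega>)) \<in> borel_measurable M"
proof -
  note [measurable] = prob_vector_measurable[OF assms(1)] prob_vector_measurable[OF assms(2)]
  show ?thesis
    unfolding chi_sq_def case_prod_beta by measurable
qed

lemma sets_Ball_pairs:
  assumes "\<And>e. e \<in> pairs n \<Longrightarrow> {\<omega> \<in> space M. P \<omega> (fst e) (snd e)} \<in> sets M"
  shows "{\<omega> \<in> space M. \<forall>(i, j)\<in>pairs n. P \<omega> i j} \<in> sets M"
  unfolding case_prod_beta
  using assms finite_pairs by (intro sets.sets_Collect_finite_All) auto

lemma sets_le_const:
  assumes "prob_vector n M p"
  shows "{\<omega> \<in> space M. \<forall>(i, j)\<in>pairs n. p \<omega> i j \<le> (b :: real)} \<in> sets M"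
proof (rule sets_Ball_pairs)
  note [measurable] = prob_vector_measurable[OF assms]
  fix e assume [measurable]: "e \<in> pairs n"
  show "{\<omega> \<in> space M. p \<omega> (fst e) (snd e) \<le> b} \<in> sets M" by measurable
qed

lemma sets_comparable:
  assumes "prob_vector n M p" "prob_vector n M p'"
  shows "{\<omega> \<in> space M. \<forall>(i, j)\<in>pairs n. c * p \<omega> i j \<le> p' \<omega> i j \<and> p' \<omega> i j \<le> (b :: real)} \<in> sets M"
proof (rule sets_Ball_pairs)
  note [measurable] = prob_vector_measurable[OF assms(1)] prob_vector_measurable[OF assms(2)]
  fix e assume [measurable]: "e \<in> pairs n"
  show "{\<omega> \<in> space M. c * p \<omega> (fst e) (snd e) \<le> p' \<omega> (fst e) (snd e) \<and> p' \<omega> (fst e) (snd e) \<le> b} \<in> sets M"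
    by measurable
qed

lemma sets_well_conditioned:
  assumes "prob_vector n M p" "prob_vector n M p'"
  shows "{\<omega> \<in> space M. well_conditioned n C (p \<omega>) (p' \<omega>)} \<in> sets M"
proof -
  note [measurable] = measurable_chi_sq[OF assms]
  have "{\<omega> \<in> space M. chi_sq n (p \<omega>) (p' \<omega>) \<le> ennreal C} \<in> sets M" by measurable
  then show ?thesis
    unfolding well_conditioned_def using sets_le_const[OF assms(1), of "0.9"]
    by (rule sets.sets_Collect_conj)
qed

section \<open>Probability and integral estimates\<close>

lemma (in prob_space) prob_conj_ge:
  assumes "{\<omega> \<in> space M. P \<omega>} \<in> events" "{\<omega> \<in> space M. Q \<omega>} \<in> events"
  shows "prob {\<omega> \<in> space M. P \<omega>} + prob {\<omega> \<in> space M. Q \<omega>} - 1 \<le> prob {\<omega> \<in> space M. P \<omega> \<and> Q \<omega>}"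
proof -
  let ?PQ = "{\<omega> \<in> space M. P \<omega> \<and> Q \<omega>}" and ?nQ = "space M - {\<omega> \<in> space M. Q \<omega>}"
  have "?PQ \<in> events" by (rule sets.sets_Collect_conj[OF assms(2,1)])
  then have "prob {\<omega> \<in> space M. P \<omega>} \<le> prob (?PQ \<union> ?nQ)"
    using assms by (intro finite_measure_mono) auto
  also have "\<dots> \<le> prob ?PQ + prob ?nQ"
    using \<open>?PQ \<in> events\<close> assms by (intro measure_Un_le) auto
  also have "prob ?nQ = 1 - prob {\<omega> \<in> space M. Q \<omega>}"
    by (rule prob_compl) fact
  finally show ?thesis by simp
qed

lemma (in prob_space) prob_well_conditioned_ge:
  assumes "prob_vector n M p" "prob_vector n M p'"
  shows "prob {\<omega> \<in> space M. \<forall>(i, j)\<in>pairs n. p \<omega> i j \<le> 0.9} -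
      prob {\<omega> \<in> space M. chi_sq n (p \<omega>) (p' \<omega>) > ennreal C} \<le>
    prob {\<omega> \<in> space M. well_conditioned n C (p \<omega>) (p' \<omega>)}"
proof -
  note [measurable] = measurable_chi_sq[OF assms]
  have le: "{\<omega> \<in> space M. chi_sq n (p \<omega>) (p' \<omega>) \<le> ennreal C} \<in> events" by measurable
  have "{\<omega> \<in> space M. chi_sq n (p \<omega>) (p' \<omega>) > ennreal C} =
      space M - {\<omega> \<in> space M. chi_sq n (p \<omega>) (p' \<omega>) \<le> ennreal C}"
    by auto
  then have "prob {\<omega> \<in> space M. chi_sq n (p \<omega>) (p' \<omega>) > ennreal C} =
      1 - prob {\<omega> \<in> space M. chi_sq n (p \<omega>) (p' \<omega>) \<le> ennreal C}"
    using prob_compl[OF le] by simp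
  then show ?thesis
    using prob_conj_ge[OF sets_le_const[OF assms(1), where b = "0.9"] le]
    unfolding well_conditioned_def by linarith
qed

text \<open>Turns a bound valid on the good event into one for expectations: off \<open>E\<close>
  the bound \<open>f \<omega> \<le> 1\<close> is absorbed by the indicator of the complement.
  Contiguity uses it with positive slope \<open>a\<close>, asymptotic equivalence with
  \<open>a = 0\<close>.\<close>

lemma (in prob_space) integral_le_affine_on:
  fixes f g :: "'a \<Rightarrow> real"
  assumes [measurable]: "f \<in> borel_measurable M" "g \<in> borel_measurable M" "E \<in> events"
    and f: "\<And>\<omega>. \<omega> \<in> space M \<Longrightarrow> f \<omega> \<le> 1 \<and> 0 \<le> f \<omega>"
    and g: "\<And>\<omega>. \<omega> \<in> space M \<Longrightarrow> 0 \<le> g \<omega> \<and> g \<omega> \<le> 1"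
    and "0 \<le> a" "0 \<le> b" and fg: "\<And>\<omega>. \<omega> \<in> E \<Longrightarrow> f \<omega> \<le> b + a * g \<omega>"
  shows "(\<integral>\<omega>. f \<omega> \<partial>M) \<le> b + a * (\<integral>\<omega>. g \<omega> \<partial>M) + (1 - prob E)"
proof -
  have int: "integrable M f" "integrable M g"
    using f g by (auto intro!: integrable_const_bound[where B = 1])
  have "(\<integral>\<omega>. f \<omega> \<partial>M) \<le> (\<integral>\<omega>. b + a * g \<omega> + indicator (space M - E) \<omega> \<partial>M)"
  proof (rule integral_mono)
    show "f \<omega> \<le> b + a * g \<omega> + indicator (space M - E) \<omega>" if "\<omega> \<in> space M" for \<omega>
      using f[OF that] g[OF that] fg[of \<omega>] that \<open>0 \<le> a\<close> \<open>0 \<le> b\<close>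
      by (cases "\<omega> \<in> E") (auto intro: order_trans[of _ 1])
  qed (use int in \<open>auto intro!: Bochner_Integration.integrable_add integrable_real_indicator simp: emeasure_eq_measure\<close>)
  also have "\<dots> = b + a * (\<integral>\<omega>. g \<omega> \<partial>M) + prob (space M - E)"
    using int by (simp add: prob_space emeasure_eq_measure Int_absorb2)
  also have "prob (space M - E) = 1 - prob E"
    by (rule prob_compl) fact
  finally show ?thesis .
qed

section \<open>From good events to the asymptotic statements\<close>

text \<open>Combines the 0.9 bound with tightness of the chi-squared sum. Asking for it only for
  large \<open>n\<close> fits the hypotheses that hold with high probability, and in this form it
  can be passed to the exchanged pair.\<close>

definition chi_tight ::
  "(nat \<Rightarrow> 'a measure) \<Rightarrow> (nat \<Rightarrow> 'a \<Rightarrow> nat \<Rightarrow> nat \<Rightarrow> real) \<Rightarrow> (nat \<Rightarrow> 'a \<Rightarrow> nat \<Rightarrow> nat \<Rightarrow> real) \<Rightarrow> bool" where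
  "chi_tight M p p' \<longleftrightarrow> (\<forall>\<epsilon>>0. \<exists>C\<ge>0. \<forall>\<^sub>F n in sequentially.
     1 - \<epsilon> < measure (M n) {\<omega> \<in> space (M n). well_conditioned n C (p n \<omega>) (p' n \<omega>)})"

text \<open>The assumptions are symmetric in \<open>p\<close> and \<open>p'\<close>, so every result
  here can also be used with the two exchanged.\<close>

locale random_edge_probabilities =
  fixes M :: "nat \<Rightarrow> 'a measure" and p p' :: "nat \<Rightarrow> 'a \<Rightarrow> nat \<Rightarrow> nat \<Rightarrow> real"
  assumes prob_space_M: "\<And>n. prob_space (M n)"
    and p: "\<And>n. prob_vector n (M n) (p n)"
    and p': "\<And>n. prob_vector n (M n) (p' n)"
begin

lemma edge_probabilities:
  assumes "well_conditioned n C (p n \<omega>) (p' n \<omega>)" "0 \<le> C" "\<omega> \<in> space (M n)"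
  shows "edge_probabilities (pairs n) (\<lambda>(i, j). p n \<omega> i j) (\<lambda>(i, j). p' n \<omega> i j) C"
  using assms prob_vectorD[OF p] prob_vectorD[OF p']
  by (intro well_conditioned_imp_edge_probabilities) auto

lemma measure_sq_le:
  assumes "well_conditioned n C (p n \<omega>) (p' n \<omega>)" "0 \<le> C" "\<omega> \<in> space (M n)"
  shows "(measure (fixed_random_graph n (p' n \<omega>)) A)\<^sup>2 \<le>
    measure (fixed_random_graph n (p n \<omega>)) A * exp (10 * C)"
  using edge_probabilities.sum_weight_sq_le[OF edge_probabilities[OF assms], of "A \<inter> graphs n"]
    prob_vectorD[OF p assms(3)] prob_vectorD[OF p' assms(3)]
  by (simp add: measure_fixed_random_graph graphs_def)

lemma measure_diff_le:
  assumes "well_conditioned n C (p n \<omega>) (p' n \<omega>)" "0 \<le> C" "\<omega> \<in> space (M n)"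
  shows "\<bar>measure (fixed_random_graph n (p n \<omega>)) A - measure (fixed_random_graph n (p' n \<omega>)) A\<bar>
    \<le> sqrt (exp (10 * C) - 1)"
  using edge_probabilities.sum_weight_diff_sq_le[OF edge_probabilities[OF assms], of "A \<inter> graphs n"]
    prob_vectorD[OF p assms(3)] prob_vectorD[OF p' assms(3)]
  by (intro real_le_rsqrt) (simp add: measure_fixed_random_graph graphs_def power2_commute)

text \<open>The bound Q^2 \<le> P exp (10 C) is made linear before integrating: either Q \<le>
  \<delta>, or \<delta> Q \<le> Q^2 and hence Q \<le> K P with K = exp (10 C) / \<delta>.\<close>

lemma contiguous_if_chi_tight:
  assumes tight: "chi_tight M p p'"
  shows "contiguous (\<lambda>n. random_graph n (M n) (p' n)) (\<lambda>n. random_graph n (M n) (p n))"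
  unfolding contiguous_def
proof (intro allI impI)
  fix A :: "nat \<Rightarrow> graph set"
  assume lim: "(\<lambda>n. measure (random_graph n (M n) (p n)) (A n)) \<longlonglongrightarrow> 0"
  show "(\<lambda>n. measure (random_graph n (M n) (p' n)) (A n)) \<longlonglongrightarrow> 0"
  proof (rule tendstoI)
    fix \<epsilon> :: real assume "0 < \<epsilon>"
    \<comment> \<open>One third each for the outcomes with small Q, for K times the integral of P,
      and for the complement of the good event.\<close>
    define \<delta> where "\<delta> = \<epsilon> / 3"
    have "0 < \<delta>" using \<open>0 < \<epsilon>\<close> by (simp add: \<delta>_def)
    obtain C where "0 \<le> C" and C: "\<forall>\<^sub>F n in sequentially.
        1 - \<delta> < measure (M n) {\<omega> \<in> space (M n). well_conditioned n C (p n \<omega>) (p' n \<omega>)}"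
      using tight \<open>0 < \<delta>\<close> unfolding chi_tight_def by blast
    define K where "K = exp (10 * C) / \<delta>"
    have "0 < K" using \<open>0 < \<delta>\<close> by (simp add: K_def)
    have "\<forall>\<^sub>F n in sequentially. measure (random_graph n (M n) (p n)) (A n) < \<delta> / K"
      using \<open>0 < \<delta>\<close> \<open>0 < K\<close> by (intro order_tendstoD[OF lim]) simp
    with C show "\<forall>\<^sub>F n in sequentially. dist (measure (random_graph n (M n) (p' n)) (A n)) 0 < \<epsilon>"
    proof eventually_elim
      fix n
      let ?E = "{\<omega> \<in> space (M n). well_conditioned n C (p n \<omega>) (p' n \<omega>)}"
      let ?P = "\<lambda>\<omega>. measure (fixed_random_graph n (p n \<omega>)) (A n)"
      let ?Q = "\<lambda>\<omega>. measure (fixed_random_graph n (p' n \<omega>)) (A n)"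
      assume E: "1 - \<delta> < measure (M n) ?E"
        and small: "measure (random_graph n (M n) (p n)) (A n) < \<delta> / K"
      have "?Q \<omega> \<le> \<delta> + K * ?P \<omega>" if "\<omega> \<in> ?E" for \<omega>
      proof (cases "?Q \<omega> \<le> \<delta>")
        case True
        then show ?thesis using \<open>0 < K\<close> by (simp add: add_increasing2)
      next
        case False
        then have "\<delta> * ?Q \<omega> \<le> (?Q \<omega>)\<^sup>2"
          unfolding power2_eq_square by (intro mult_right_mono) auto
        also have "\<dots> \<le> ?P \<omega> * exp (10 * C)"
          using that \<open>0 \<le> C\<close> by (intro measure_sq_le) auto
        finally have "?Q \<omega> \<le> K * ?P \<omega>"
          using \<open>0 < \<delta>\<close> by (simp add: K_def field_simps)
        then show ?thesis using \<open>0 < \<delta>\<close> by simp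
      qed
      then have "(\<integral>\<omega>. ?Q \<omega> \<partial>M n) \<le> \<delta> + K * (\<integral>\<omega>. ?P \<omega> \<partial>M n) + (1 - measure (M n) ?E)"
        using \<open>0 < \<delta>\<close> \<open>0 < K\<close> p p'
        by (intro prob_space.integral_le_affine_on[OF prob_space_M] measurable_fixed_random_graph
              sets_well_conditioned) auto
      moreover have "K * (\<integral>\<omega>. ?P \<omega> \<partial>M n) < \<delta>"
        using small \<open>0 < K\<close> by (simp add: measure_random_graph[OF prob_space_M p] field_simps)
      ultimately show "dist (measure (random_graph n (M n) (p' n)) (A n)) 0 < \<epsilon>"
        using E by (simp add: measure_random_graph[OF prob_space_M p'] \<delta>_def)
    qed
  qed
qed

lemma asymp_equivalent_if_small_o_p_one:
  assumes whp: "whp M (\<lambda>n \<omega>. \<forall>(i, j)\<in>pairs n. p n \<omega> i j \<le> 0.9)"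
    and small: "small_o_p_one M (\<lambda>n \<omega>. chi_sq n (p n \<omega>) (p' n \<omega>))"
  shows "asymp_equivalent (\<lambda>n. random_graph n (M n) (p n)) (\<lambda>n. random_graph n (M n) (p' n))"
  unfolding asymp_equivalent_def
proof (intro allI impI tendstoI)
  fix A :: "nat \<Rightarrow> graph set" and \<epsilon> :: real assume "0 < \<epsilon>"
  \<comment> \<open>By continuity at 0 some positive \<open>C\<close> makes the bound of
    \<open>measure_diff_le\<close> smaller than \<epsilon> / 2; positivity allows it to serve as the
    threshold in \<open>small_o_p_one\<close>.\<close>
  have "((\<lambda>C. sqrt (exp (10 * C) - 1)) \<longlongrightarrow> sqrt (exp (10 * 0) - 1)) (at_right (0::real))"
    by (intro tendsto_intros)
  then have "\<forall>\<^sub>F C in at_right (0::real). sqrt (exp (10 * C) - 1) < \<epsilon> / 2"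
    using \<open>0 < \<epsilon>\<close> by (intro order_tendstoD) auto
  then obtain C where "0 < C" and C: "sqrt (exp (10 * C) - 1) < \<epsilon> / 2"
    using eventually_happens[OF eventually_conj[OF _ eventually_at_right_less[of "0::real"]]]
    by (metis trivial_limit_at_right_real)
  have "(\<lambda>n. measure (M n) {\<omega> \<in> space (M n). \<forall>(i, j)\<in>pairs n. p n \<omega> i j \<le> 0.9} -
      measure (M n) {\<omega> \<in> space (M n). chi_sq n (p n \<omega>) (p' n \<omega>) > ennreal C}) \<longlonglongrightarrow> 1 - 0"
    using whp small \<open>0 < C\<close> unfolding whp_def small_o_p_one_def by (intro tendsto_diff) auto
  then have "\<forall>\<^sub>F n in sequentially. 1 - \<epsilon> / 2 <
      measure (M n) {\<omega> \<in> space (M n). \<forall>(i, j)\<in>pairs n. p n \<omega> i j \<le> 0.9} -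
      measure (M n) {\<omega> \<in> space (M n). chi_sq n (p n \<omega>) (p' n \<omega>) > ennreal C}"
    using \<open>0 < \<epsilon>\<close> by (intro order_tendstoD) auto
  then show "\<forall>\<^sub>F n in sequentially. dist (measure (random_graph n (M n) (p n)) (A n) -
      measure (random_graph n (M n) (p' n)) (A n)) 0 < \<epsilon>"
  proof eventually_elim
    case (elim n)
    interpret prob_space "M n" by (rule prob_space_M)
    let ?E = "{\<omega> \<in> space (M n). well_conditioned n C (p n \<omega>) (p' n \<omega>)}"
    let ?P = "\<lambda>\<omega>. measure (fixed_random_graph n (p n \<omega>)) (A n)"
    let ?Q = "\<lambda>\<omega>. measure (fixed_random_graph n (p' n \<omega>)) (A n)"
    have [measurable]: "?P \<in> borel_measurable (M n)" "?Q \<in> borel_measurable (M n)"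
      by (rule measurable_fixed_random_graph p p')+
    have E: "1 - \<epsilon> / 2 < prob ?E"
      using elim prob_well_conditioned_ge[OF p p'] by (rule less_le_trans)
    have "\<bar>(\<integral>\<omega>. ?P \<omega> \<partial>M n) - (\<integral>\<omega>. ?Q \<omega> \<partial>M n)\<bar> = \<bar>\<integral>\<omega>. ?P \<omega> - ?Q \<omega> \<partial>M n\<bar>"
      by (subst Bochner_Integration.integral_diff) (auto intro!: integrable_const_bound[where B = 1])
    also have "\<dots> \<le> (\<integral>\<omega>. \<bar>?P \<omega> - ?Q \<omega>\<bar> \<partial>M n)"
      by (rule integral_abs_bound)
    \<comment> \<open>On the good event the difference is bounded by a constant, so slope and
      comparison function are both taken to be 0.\<close>
    also have "\<dots> \<le> sqrt (exp (10 * C) - 1) + 0 * (\<integral>\<omega>. 0 \<partial>M n) + (1 - prob ?E)"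
    proof (rule integral_le_affine_on)
      show "\<bar>?P \<omega> - ?Q \<omega>\<bar> \<le> 1 \<and> 0 \<le> \<bar>?P \<omega> - ?Q \<omega>\<bar>" for \<omega>
        by (smt (verit) measure_nonneg measure_pmf.prob_le_1)
      show "\<bar>?P \<omega> - ?Q \<omega>\<bar> \<le> sqrt (exp (10 * C) - 1) + 0 * 0" if "\<omega> \<in> ?E" for \<omega>
        using measure_diff_le[of n C \<omega> "A n"] that \<open>0 < C\<close> by simp
    qed (use \<open>0 < C\<close> sets_well_conditioned[OF p p'] in auto)
    finally show ?case
      using C E by (simp add: measure_random_graph[OF prob_space_M] p p')
  qed
qed

lemma chi_tight_if_big_O_p_one:
  assumes whp: "whp M (\<lambda>n \<omega>. \<forall>(i, j)\<in>pairs n. p n \<omega> i j \<le> 0.9)"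
    and big: "big_O_p_one M (\<lambda>n \<omega>. chi_sq n (p n \<omega>) (p' n \<omega>))"
  shows "chi_tight M p p'"
  unfolding chi_tight_def
proof (intro allI impI)
  fix \<epsilon> :: real assume "0 < \<epsilon>"
  then obtain C where "0 \<le> C" and C: "\<And>n. measure (M n)
      {\<omega> \<in> space (M n). chi_sq n (p n \<omega>) (p' n \<omega>) > ennreal C} < \<epsilon> / 2"
    using big unfolding big_O_p_one_def by (meson half_gt_zero)
  have "\<forall>\<^sub>F n in sequentially. 1 - \<epsilon> / 2 <
      measure (M n) {\<omega> \<in> space (M n). \<forall>(i, j)\<in>pairs n. p n \<omega> i j \<le> 0.9}"
    using whp \<open>0 < \<epsilon>\<close> unfolding whp_def by (intro order_tendstoD) auto
  then have "\<forall>\<^sub>F n in sequentially.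
      1 - \<epsilon> < measure (M n) {\<omega> \<in> space (M n). well_conditioned n C (p n \<omega>) (p' n \<omega>)}"
  proof eventually_elim
    case (elim n)
    then show ?case
      using C[of n] prob_space.prob_well_conditioned_ge[OF prob_space_M p p', of n C] by linarith
  qed
  with \<open>0 \<le> C\<close> show "\<exists>C\<ge>0. \<forall>\<^sub>F n in sequentially.
      1 - \<epsilon> < measure (M n) {\<omega> \<in> space (M n). well_conditioned n C (p n \<omega>) (p' n \<omega>)}"
    by blast
qed

text \<open>The event of \<open>chi_tight\<close> and the comparison event each fail with
  probability below \<epsilon> / 2 for large \<open>n\<close>; on their intersection
  \<open>well_conditioned_swap\<close> applies, which gives the witness
  \<open>C / c\<close>.\<close>

lemma chi_tight_swap:
  assumes tight: "chi_tight M p p'" and "0 < c"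
    and whp: "whp M (\<lambda>n \<omega>. \<forall>(i, j)\<in>pairs n. c * p n \<omega> i j \<le> p' n \<omega> i j \<and> p' n \<omega> i j \<le> 0.9)"
  shows "chi_tight M p' p"
  unfolding chi_tight_def
proof (intro allI impI)
  fix \<epsilon> :: real assume "0 < \<epsilon>"
  then obtain C where "0 \<le> C" and C: "\<forall>\<^sub>F n in sequentially. 1 - \<epsilon> / 2 <
      measure (M n) {\<omega> \<in> space (M n). well_conditioned n C (p n \<omega>) (p' n \<omega>)}"
    using tight unfolding chi_tight_def by (meson half_gt_zero)
  have "\<forall>\<^sub>F n in sequentially. 1 - \<epsilon> / 2 < measure (M n) {\<omega> \<in> space (M n).
      \<forall>(i, j)\<in>pairs n. c * p n \<omega> i j \<le> p' n \<omega> i j \<and> p' n \<omega> i j \<le> 0.9}"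
    using whp \<open>0 < \<epsilon>\<close> unfolding whp_def by (intro order_tendstoD) auto
  with C have "\<forall>\<^sub>F n in sequentially.
      1 - \<epsilon> < measure (M n) {\<omega> \<in> space (M n). well_conditioned n (C / c) (p' n \<omega>) (p n \<omega>)}"
  proof eventually_elim
    case (elim n)
    interpret prob_space "M n" by (rule prob_space_M)
    have "1 - \<epsilon> < prob {\<omega> \<in> space (M n). well_conditioned n C (p n \<omega>) (p' n \<omega>) \<and>
        (\<forall>(i, j)\<in>pairs n. c * p n \<omega> i j \<le> p' n \<omega> i j \<and> p' n \<omega> i j \<le> 0.9)}"
      using elim prob_conj_ge[OF sets_well_conditioned[OF p p', where C = C]
          sets_comparable[OF p p', where c = c and b = "0.9"]]
      by linarith
    also have "\<dots> \<le> prob {\<omega> \<in> space (M n). well_conditioned n (C / c) (p' n \<omega>) (p n \<omega>)}"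
      using \<open>0 \<le> C\<close> \<open>0 < c\<close> prob_vectorD[OF p] sets_well_conditioned[OF p' p]
      by (intro finite_measure_mono) (auto intro!: well_conditioned_swap)
    finally show ?case .
  qed
  moreover have "0 \<le> C / c" using \<open>0 \<le> C\<close> \<open>0 < c\<close> by simp
  ultimately show "\<exists>C\<ge>0. \<forall>\<^sub>F n in sequentially.
      1 - \<epsilon> < measure (M n) {\<omega> \<in> space (M n). well_conditioned n C (p' n \<omega>) (p n \<omega>)}"
    by blast
qed

end

theorem corollary2p12:
  fixes M :: "nat \<Rightarrow> 'a measure"
    and p p' :: "nat \<Rightarrow> 'a \<Rightarrow> nat \<Rightarrow> nat \<Rightarrow> real"
  assumes "\<And>n. prob_space (M n)"
    and "\<And>n. prob_vector n (M n) (p n)"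
    and "\<And>n. prob_vector n (M n) (p' n)"
    and "whp M (\<lambda>n \<omega>. \<forall>(i, j) \<in> pairs n. p n \<omega> i j \<le> 0.9)"
  defines "S \<equiv> \<lambda>n \<omega>. chi_sq n (p n \<omega>) (p' n \<omega>)"
    and "G \<equiv> \<lambda>n. random_graph n (M n) (p n)"
    and "G' \<equiv> \<lambda>n. random_graph n (M n) (p' n)"
  shows "(small_o_p_one M S \<longrightarrow> asymp_equivalent G G') \<and>
         (big_O_p_one M S \<longrightarrow> contiguous G' G) \<and>
         (big_O_p_one M S \<and>
          (\<exists>c::real. c > 0 \<and>
             whp M (\<lambda>n \<omega>. \<forall>(i, j) \<in> pairs n.
               c * p n \<omega> i j \<le> p' n \<omega> i j \<and> p' n \<omega> i j \<le> 0.9)) \<longrightarrow>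
          contiguous G G' \<and> contiguous G' G)"
proof -
  interpret random_edge_probabilities M p p'
    using assms(1-3) by (intro random_edge_probabilities.intro)
  \<comment> \<open>The exchanged copy yields the direction \<open>contiguous G G'\<close> of the
    third claim.\<close>
  interpret swap: random_edge_probabilities M p' p
    using assms(1-3) by (intro random_edge_probabilities.intro)
  note tight = chi_tight_if_big_O_p_one[OF assms(4)]
  show ?thesis
    unfolding S_def G_def G'_def
    using asymp_equivalent_if_small_o_p_one[OF assms(4)] contiguous_if_chi_tight[OF tight]
      swap.contiguous_if_chi_tight chi_tight_swap[OF tight]
    by blast
qed

end
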